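(* Let $n\ge1$, let $\mathcal{E}$ be a Hilbert space, let $L\in\mathcal{B}(\mathcal{E},\mathcal{F}_n^2\otimes\mathcal{E})$, and suppose $(W_L,S^{\mathcal{E}})$ is an isometric representation, i.e. the odometer map $W_L$ is an isometry. Then the following are equivalent: (1) $W_L$ is Fredholm; (2) $W_L$ is essentially normal; (3) $\dim(\mathcal{E}_L\ominus L\mathcal{E})<\infty$. In this case, $\operatorname{ind}(W_L)=-\dim(\mathcal{E}_L\ominus L\mathcal{E})$.
   Context: Hilbert spaces are separable and complex; $\mathcal{B}(\mathcal{H},\mathcal{K})$ denotes bounded linear operators. $F_n^+$ is the free monoid of words $\mu=\mu_1\cdots\mu_m$ in the letters $1,\dots,n$, with empty word $\emptyset$. The full Fock space $\mathcal{F}_n^2=\mathbb{C}\Omega\oplus\bigoplus_{k\ge1}(\mathbb{C}^n)^{\otimes k}$ has orthonormal basis $e_\mu=e_{\mu_1}\otimes\cdots\otimes e_{\mu_m}$, $\mu\in F_n^+$, with $e_\emptyset=\Omega$; $e_k^m:=e_k^{\otimes m}$, $e_k^0=\Omega$, and $\Omega$ acts as a unit for left tensoring. $S_i f=e_i\otimes f$ is the $i$-th left creation operator on $\mathcal{F}_n^2$, $S^{\mathcal{E}}=(S_1\otimes I_{\mathcal{E}},\dots,S_n\otimes I_{\mathcal{E}})$, and $e_1^p\otimes f$ means $(S_1^p\otimes I_{\mathcal{E}})f$ for $f\in\mathcal{F}_n^2\otimes\mathcal{E}$. Odometer map: for $L\in\mathcal{B}(\mathcal{E},\mathcal{F}_n^2\otimes\mathcal{E})$,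 $W_L$ is the operator on $\mathcal{F}_n^2\otimes\mathcal{E}$ given by $W_L(\Omega\otimes\eta)=L\eta$; $W_L(e_n^m\otimes\eta)=e_1^m\otimes L\eta$ for $m\ge1$; and, for a nonempty word $\mu=\mu_1\cdots\mu_m$ having some letter $\ne n$, with $k$ the smallest index such that $\mu_k\neq n$, $W_L(e_\mu\otimes\eta)=e_1^{k-1}\otimes e_{\mu_k+1}\otimes e_{\mu_{k+1}}\otimes\cdots\otimes e_{\mu_m}\otimes\eta$. The pair $(W_L,S^{\mathcal{E}})$ is a (Fock) representation of the odometer semigroup, called isometric when $W_L$ is a (bounded, everywhere defined) isometry. $\mathcal{E}_L:=\overline{\mathrm{span}}\{e_1^m\otimes\eta:m\ge0,\eta\in\mathcal{E}\}\ominus\overline{\mathrm{span}}\{e_1^p\otimes L\zeta:p\ge1,\zeta\in\mathcal{E}\}$, where $\mathcal{A}\ominus\mathcal{B}$ means $\mathcal{A}\cap\mathcal{B}^\perp$. A bounded operator $T$ is Fredholm if $\dim\ker T<\infty$, $\mathrm{ran}\,T$ is closed and $\dim\ker T^*<\infty$; then $\operatorname{ind}(T)=\dim\ker T-\dim\ker T^*$. $T$ is essentially normal if $T^*T-TT^*$ is compact. *)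

theory Defs
  imports "HOL-Analysis.Analysis"
begin

section \<open>Complex Hilbert spaces\<close>

text \<open>
  A complex Hilbert space is a complete real inner product space (with inner product
  \<open>Re \<langle>x, y\<rangle>\<close> and the norm, metric and topology that come with it) together with a
  compatible complex scalar multiplication and a sesquilinear form. The form is linear in its
  first argument.  Separability is not part of the class; it is the class
  \<^class>\<open>second_countable_topology\<close>.
\<close>

class complex_hilbert = real_inner + complete_space +
  fixes scaleC :: "complex \<Rightarrow> 'a \<Rightarrow> 'a"  (infixr "*\<^sub>C" 75)
    and cinner :: "'a \<Rightarrow> 'a \<Rightarrow> complex"
  assumes scaleC_add_right: "a *\<^sub>C (x + y) = a *\<^sub>C x + a *\<^sub>C y"
    and scaleC_add_left: "(a + b) *\<^sub>C x = a *\<^sub>C x + b *\<^sub>C x"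
    and scaleC_scaleC: "a *\<^sub>C b *\<^sub>C x = (a * b) *\<^sub>C x"
    and scaleR_scaleC: "r *\<^sub>R x = complex_of_real r *\<^sub>C x"
    and cinner_commute: "cinner x y = cnj (cinner y x)"
    and cinner_add_left: "cinner (x + y) z = cinner x z + cinner y z"
    and cinner_scaleC_left: "cinner (a *\<^sub>C x) y = a * cinner x y"
    and inner_eq_Re_cinner: "inner x y = Re (cinner x y)"

lemma scaleC_one: "1 *\<^sub>C x = x" for x :: "'a::complex_hilbert"
  using scaleR_scaleC[of 1 x] by simp

lemma Im_cinner: "Im (cinner x y) = inner (- \<i> *\<^sub>C x) y" for x :: "'a::complex_hilbert"
  by (simp only: inner_eq_Re_cinner cinner_scaleC_left) simp

lemma cinner_eq_inner: "cinner x y = Complex (inner x y) (inner (- \<i> *\<^sub>C x) y)"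
  for x :: "'a::complex_hilbert"
  by (rule complex_eqI) (simp_all only: complex.sel inner_eq_Re_cinner Im_cinner)

lemma norm_scaleC: "norm (a *\<^sub>C x) = cmod a * norm x" for x :: "'a::complex_hilbert"
proof -
  have "cinner (a *\<^sub>C x) (a *\<^sub>C x) = a * cnj a * cinner x x"
    using cinner_commute[of x "a *\<^sub>C x"] cinner_commute[of x x]
    by (simp add: cinner_scaleC_left)
  also have "a * cnj a = complex_of_real ((cmod a)\<^sup>2)"
    by (rule complex_norm_square[symmetric])
  finally have "inner (a *\<^sub>C x) (a *\<^sub>C x) = (cmod a)\<^sup>2 * inner x x"
    by (simp add: inner_eq_Re_cinner)
  then show ?thesis
    by (simp add: norm_eq_sqrt_inner real_sqrt_mult)
qed

instance complex_hilbert \<subseteq> banach ..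

instantiation complex :: complex_hilbert
begin

definition "scaleC a z = a * z" for a z :: complex
definition "cinner z w = z * cnj w" for z w :: complex

instance
  by standard (auto simp: scaleC_complex_def cinner_complex_def algebra_simps
      scaleR_conv_of_real inner_complex_def)

end

global_interpretation complex_vector: vector_space "scaleC :: complex \<Rightarrow> 'a \<Rightarrow> 'a::complex_hilbert"
  defines cspan = complex_vector.span
    and cdim = complex_vector.dim
  by unfold_locales (simp_all add: scaleC_add_right scaleC_add_left scaleC_scaleC scaleC_one)

abbreviation clinear :: "('a::complex_hilbert \<Rightarrow> 'b::complex_hilbert) \<Rightarrow> bool"
  where "clinear \<equiv> Vector_Spaces.linear scaleC scaleC"

definition bounded_clinear :: "('a::complex_hilbert \<Rightarrow> 'b::complex_hilbert) \<Rightarrow> bool"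
  where "bounded_clinear T \<longleftrightarrow> clinear T \<and> (\<exists>K. \<forall>x. norm (T x) \<le> K * norm x)"

definition isometry :: "('a::complex_hilbert \<Rightarrow> 'b::complex_hilbert) \<Rightarrow> bool"
  where "isometry T \<longleftrightarrow> bounded_clinear T \<and> (\<forall>x. norm (T x) = norm x)"

text \<open>By the Riesz representation theorem the defining property determines the adjoint of a
  bounded operator.\<close>

definition cadjoint :: "('a::complex_hilbert \<Rightarrow> 'b::complex_hilbert) \<Rightarrow> 'b \<Rightarrow> 'a"
  where "cadjoint T = (SOME S. \<forall>x y. cinner (T x) y = cinner x (S y))"

definition ker :: "('a::complex_hilbert \<Rightarrow> 'b::complex_hilbert) \<Rightarrow> 'a set"
  where "ker T = {x. T x = 0}"

text \<open>The complex dimension of a subspace \<open>V\<close> is \<open>cdim V\<close>, which is meaningful only under the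
  following condition (\<^term>\<open>cdim V\<close> is a natural number, and \<open>0\<close> for infinite-dimensional
  \<open>V\<close>).\<close>

definition finite_cdim :: "'a::complex_hilbert set \<Rightarrow> bool"
  where "finite_cdim V \<longleftrightarrow> (\<exists>B. finite B \<and> V \<subseteq> cspan B)"

definition ominus :: "'a::complex_hilbert set \<Rightarrow> 'a set \<Rightarrow> 'a set"  (infixl "\<ominus>" 65)
  where "A \<ominus> B = {x \<in> A. \<forall>y \<in> B. cinner x y = 0}"

definition compact_operator :: "('a::complex_hilbert \<Rightarrow> 'b::complex_hilbert) \<Rightarrow> bool"
  where "compact_operator T \<longleftrightarrow> bounded_clinear T \<and> compact (closure (T ` cball 0 1))"

definition fredholm :: "('a::complex_hilbert \<Rightarrow> 'b::complex_hilbert) \<Rightarrow> bool"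
  where "fredholm T \<longleftrightarrow>
    bounded_clinear T \<and> finite_cdim (ker T) \<and> closed (range T) \<and> finite_cdim (ker (cadjoint T))"

definition fredholm_index :: "('a::complex_hilbert \<Rightarrow> 'b::complex_hilbert) \<Rightarrow> int"
  where "fredholm_index T = int (cdim (ker T)) - int (cdim (ker (cadjoint T)))"

definition essentially_normal :: "('a::complex_hilbert \<Rightarrow> 'a) \<Rightarrow> bool"
  where "essentially_normal T \<longleftrightarrow>
    bounded_clinear T \<and> compact_operator (\<lambda>x. cadjoint T (T x) - T (cadjoint T x))"


section \<open>Square-summable families\<close>

typedef (overloaded) ('i, 'e::complex_hilbert) ell2 =
    "{f :: 'i \<Rightarrow> 'e. (\<lambda>i. (norm (f i))\<^sup>2) summable_on UNIV}"
  morphisms coord Abs_ell2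
  by (rule exI[of _ "\<lambda>_. 0"]) simp

setup_lifting type_definition_ell2

lemma ell2_summable: "(\<lambda>i. (norm (coord x i))\<^sup>2) summable_on UNIV"
  using coord[of x] by simp

lemma ell2_eqI: "(\<And>i. coord x i = coord y i) \<Longrightarrow> x = y"
  by (metis coord_inject ext)

lemma sq_norm_add_le: "(norm (a + b))\<^sup>2 \<le> 2 * (norm a)\<^sup>2 + 2 * (norm b)\<^sup>2"
  for a b :: "'a::real_normed_vector"
proof -
  have "(norm (a + b))\<^sup>2 \<le> (norm a + norm b)\<^sup>2"
    by (simp add: power_mono norm_triangle_ineq)
  also have "\<dots> \<le> 2 * (norm a)\<^sup>2 + 2 * (norm b)\<^sup>2"
    using sum_squares_bound[of "norm a" "norm b"] by (simp add: power2_sum)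
  finally show ?thesis .
qed

lemma sq_summable_add:
  assumes "(\<lambda>i. (norm (f i))\<^sup>2) summable_on UNIV" "(\<lambda>i. (norm (g i))\<^sup>2) summable_on UNIV"
  shows "(\<lambda>i. (norm (f i + g i :: 'a::real_normed_vector))\<^sup>2) summable_on UNIV"
  by (rule summable_on_comparison_test[of "\<lambda>i. 2 * (norm (f i))\<^sup>2 + 2 * (norm (g i))\<^sup>2"])
    (use assms in \<open>auto intro: summable_on_add summable_on_cmult_right sq_norm_add_le\<close>)

lemma inner_summable:
  assumes "(\<lambda>i. (norm (f i))\<^sup>2) summable_on UNIV" "(\<lambda>i. (norm (g i))\<^sup>2) summable_on UNIV"
  shows "(\<lambda>i. inner (f i) (g i :: 'a::real_inner)) summable_on UNIV"
proof -
  have "norm (inner (f i) (g i)) \<le> (norm (f i))\<^sup>2 + (norm (g i))\<^sup>2" for i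
  proof -
    have "norm (inner (f i) (g i)) \<le> norm (f i) * norm (g i)"
      by (simp add: Cauchy_Schwarz_ineq2)
    also have "\<dots> \<le> 2 * norm (f i) * norm (g i)"
      by simp
    also have "\<dots> \<le> (norm (f i))\<^sup>2 + (norm (g i))\<^sup>2"
      by (rule sum_squares_bound)
    finally show ?thesis .
  qed
  then have "(\<lambda>i. norm (inner (f i) (g i))) summable_on UNIV"
    by (intro summable_on_comparison_test[OF summable_on_add[OF assms]]) auto
  then show ?thesis
    by (rule abs_summable_summable)
qed

instantiation ell2 :: (type, complex_hilbert) real_vector
begin

lift_definition zero_ell2 :: "('a, 'b) ell2" is "\<lambda>_. 0"
  by simp

lift_definition plus_ell2 :: "('a, 'b) ell2 \<Rightarrow> ('a, 'b) ell2 \<Rightarrow> ('a, 'b) ell2"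
  is "\<lambda>f g i. f i + g i"
  by (rule sq_summable_add)

lift_definition uminus_ell2 :: "('a, 'b) ell2 \<Rightarrow> ('a, 'b) ell2" is "\<lambda>f i. - f i"
  by simp

definition minus_ell2 :: "('a, 'b) ell2 \<Rightarrow> ('a, 'b) ell2 \<Rightarrow> ('a, 'b) ell2"
  where "minus_ell2 x y = x + - y"

lift_definition scaleR_ell2 :: "real \<Rightarrow> ('a, 'b) ell2 \<Rightarrow> ('a, 'b) ell2" is "\<lambda>r f i. r *\<^sub>R f i"
  unfolding norm_scaleR power_mult_distrib by (rule summable_on_cmult_right)

instance
proof
  fix x y z :: "('a, 'b) ell2" and r s :: real
  show "x + y + z = x + (y + z)" "x + y = y + x" "0 + x = x" "- x + x = 0"
    by (transfer; simp add: algebra_simps; fail)+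
  show "x - y = x + - y"
    by (rule minus_ell2_def)
  show "r *\<^sub>R (x + y) = r *\<^sub>R x + r *\<^sub>R y" "(r + s) *\<^sub>R x = r *\<^sub>R x + s *\<^sub>R x"
    "r *\<^sub>R s *\<^sub>R x = (r * s) *\<^sub>R x" "1 *\<^sub>R x = x"
    by (transfer; simp add: scaleR_add_right scaleR_add_left; fail)+
qed

end

instantiation ell2 :: (type, complex_hilbert) real_inner
begin

definition inner_ell2 :: "('a, 'b) ell2 \<Rightarrow> ('a, 'b) ell2 \<Rightarrow> real"
  where "inner_ell2 x y = (\<Sum>\<^sub>\<infinity>i. inner (coord x i) (coord y i))"

definition norm_ell2 :: "('a, 'b) ell2 \<Rightarrow> real"
  where "norm_ell2 x = sqrt (inner x x)"

definition dist_ell2 :: "('a, 'b) ell2 \<Rightarrow> ('a, 'b) ell2 \<Rightarrow> real"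
  where "dist_ell2 x y = norm (x - y)"

definition sgn_ell2 :: "('a, 'b) ell2 \<Rightarrow> ('a, 'b) ell2"
  where "sgn_ell2 x = x /\<^sub>R norm x"

definition uniformity_ell2 :: "(('a, 'b) ell2 \<times> ('a, 'b) ell2) filter"
  where "uniformity_ell2 = (INF e\<in>{0<..}. principal {(x, y). dist x y < e})"

definition open_ell2 :: "('a, 'b) ell2 set \<Rightarrow> bool"
  where "open_ell2 U \<longleftrightarrow> (\<forall>x\<in>U. eventually (\<lambda>(x', y). x' = x \<longrightarrow> y \<in> U) uniformity)"

instance
proof
  fix x y z :: "('a, 'b) ell2" and r :: real
  show "sgn x = x /\<^sub>R norm x" "dist x y = norm (x - y)" "norm x = sqrt (inner x x)"
    by (simp_all only: sgn_ell2_def dist_ell2_def norm_ell2_def)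
  show "uniformity = (INF e\<in>{0<..}. principal {(x, y). dist (x::('a, 'b) ell2) y < e})"
    by (rule uniformity_ell2_def)
  show "open U \<longleftrightarrow> (\<forall>x\<in>U. \<forall>\<^sub>F (x', y) in uniformity. x' = x \<longrightarrow> y \<in> U)"
    for U :: "('a, 'b) ell2 set"
    by (rule open_ell2_def)
  have summ: "(\<lambda>i. inner (coord x i) (coord y i)) summable_on UNIV" for x y :: "('a, 'b) ell2"
    by (rule inner_summable) (rule ell2_summable)+
  show "inner x y = inner y x"
    unfolding inner_ell2_def by (rule infsum_cong) (rule inner_commute)
  show "inner (x + y) z = inner x z + inner y z"
    unfolding inner_ell2_def plus_ell2.rep_eq inner_add_left by (rule infsum_add) (rule summ)+
  show "inner (r *\<^sub>R x) y = r * inner x y"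
    unfolding inner_ell2_def scaleR_ell2.rep_eq inner_scaleR_left
    by (rule infsum_cmult_right) (rule summ)
  show "0 \<le> inner x x"
    unfolding inner_ell2_def by (rule infsum_nonneg) simp
  show "inner x x = 0 \<longleftrightarrow> x = 0"
  proof
    assume 0: "inner x x = 0"
    have "inner (coord x i) (coord x i) = 0" for i
      by (rule nonneg_infsum_le_0D[OF _ summ[of x x]]) (use 0 in \<open>auto simp: inner_ell2_def\<close>)
    then show "x = 0"
      by (intro ell2_eqI) (simp add: zero_ell2.rep_eq)
  qed (simp add: inner_ell2_def zero_ell2.rep_eq)
qed

end

lemma coord_simps [simp]:
  fixes x y :: "('a, 'b::complex_hilbert) ell2"
  shows
  "coord 0 i = 0" "coord (x + y) i = coord x i + coord y i" "coord (- x) i = - coord x i"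
  "coord (x - y) i = coord x i - coord y i" "coord (r *\<^sub>R x) i = r *\<^sub>R coord x i"
  by (simp_all only: zero_ell2.rep_eq plus_ell2.rep_eq uminus_ell2.rep_eq minus_ell2_def
      scaleR_ell2.rep_eq add_uminus_conv_diff[where 'a = 'b])

lemma coord_sum [simp]: "coord (sum f A) i = (\<Sum>a\<in>A. coord (f a) i)"
  by (induction A rule: infinite_finite_induct) auto

lemma norm_ell2_sq: "(norm x)\<^sup>2 = (\<Sum>\<^sub>\<infinity>i. (norm (coord x i))\<^sup>2)" for x :: "('i, 'e::complex_hilbert) ell2"
  by (simp add: power2_norm_eq_inner inner_ell2_def)

lemma sum_norm_coord_le: "finite F \<Longrightarrow> (\<Sum>i\<in>F. (norm (coord x i))\<^sup>2) \<le> (norm x)\<^sup>2"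
  unfolding norm_ell2_sq by (rule finite_sum_le_infsum) (auto intro: ell2_summable)

lemma norm_coord_le: "norm (coord x i) \<le> norm x"
  using sum_norm_coord_le[of "{i}" x] by (simp add: power2_le_iff_abs_le)

instance ell2 :: (type, complex_hilbert) complete_space
proof
  fix X :: "nat \<Rightarrow> ('a, 'b) ell2"
  assume X: "Cauchy X"
  have "Cauchy (\<lambda>k. coord (X k) i)" for i
  proof (rule metric_CauchyI)
    fix e :: real assume "0 < e"
    then obtain M where "\<And>m k. m \<ge> M \<Longrightarrow> k \<ge> M \<Longrightarrow> dist (X m) (X k) < e"
      using metric_CauchyD[OF X] by blast
    moreover have "dist (coord (X m) i) (coord (X k) i) \<le> dist (X m) (X k)" for m k
      using norm_coord_le[of "X m - X k" i] by (simp add: dist_norm)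
    ultimately show "\<exists>M. \<forall>m\<ge>M. \<forall>k\<ge>M. dist (coord (X m) i) (coord (X k) i) < e"
      by (meson le_less_trans)
  qed
  then have "\<exists>l. (\<lambda>k. coord (X k) i) \<longlonglongrightarrow> l" for i
    using Cauchy_convergent convergent_def by blast
  then obtain f where f: "\<And>i. (\<lambda>k. coord (X k) i) \<longlonglongrightarrow> f i"
    by metis
  have bound: "\<exists>M. \<forall>m\<ge>M. \<forall>F. finite F \<longrightarrow> (\<Sum>i\<in>F. (norm (coord (X m) i - f i))\<^sup>2) \<le> e\<^sup>2"
    if e: "0 < e" for e :: real
  proof -
    obtain M where M: "\<And>m k. m \<ge> M \<Longrightarrow> k \<ge> M \<Longrightarrow> norm (X m - X k) < e"
      using metric_CauchyD[OF X e] by (auto simp: dist_norm)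
    have "(\<Sum>i\<in>F. (norm (coord (X m) i - f i))\<^sup>2) \<le> e\<^sup>2" if "m \<ge> M" "finite F" for m F
    proof (rule LIMSEQ_le_const2)
      show "(\<lambda>k. \<Sum>i\<in>F. (norm (coord (X m) i - coord (X k) i))\<^sup>2)
          \<longlonglongrightarrow> (\<Sum>i\<in>F. (norm (coord (X m) i - f i))\<^sup>2)"
        by (intro tendsto_intros f)
      have "(\<Sum>i\<in>F. (norm (coord (X m) i - coord (X k) i))\<^sup>2) \<le> e\<^sup>2" if "k \<ge> M" for k
      proof -
        have "(\<Sum>i\<in>F. (norm (coord (X m) i - coord (X k) i))\<^sup>2) \<le> (norm (X m - X k))\<^sup>2"
          using sum_norm_coord_le[OF \<open>finite F\<close>, of "X m - X k"] by simp
        also have "\<dots> \<le> e\<^sup>2"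
          using M[OF \<open>m \<ge> M\<close> that] by (intro power_mono) auto
        finally show ?thesis .
      qed
      then show "\<exists>N. \<forall>k\<ge>N. (\<Sum>i\<in>F. (norm (coord (X m) i - coord (X k) i))\<^sup>2) \<le> e\<^sup>2"
        by blast
    qed
    then show ?thesis
      by blast
  qed
  have summ: "(\<lambda>i. (norm (coord (X m) i - f i))\<^sup>2) summable_on UNIV"
    if "\<And>F. finite F \<Longrightarrow> (\<Sum>i\<in>F. (norm (coord (X m) i - f i))\<^sup>2) \<le> e\<^sup>2" for m and e :: real
    by (rule nonneg_bdd_above_summable_on) (use that in \<open>auto simp: bdd_above_def\<close>)
  obtain M where "\<And>F. finite F \<Longrightarrow> (\<Sum>i\<in>F. (norm (coord (X M) i - f i))\<^sup>2) \<le> 1\<^sup>2"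
    using bound[of 1] by auto
  then have "(\<lambda>i. (norm (- (coord (X M) i - f i)))\<^sup>2) summable_on UNIV"
    using summ by (simp only: norm_minus_cancel) blast
  from sq_summable_add[OF ell2_summable this, of "X M"]
  have "(\<lambda>i. (norm (f i))\<^sup>2) summable_on UNIV"
    by simp
  then have coord_f: "coord (Abs_ell2 f) = f"
    by (simp add: Abs_ell2_inverse)
  have "X \<longlonglongrightarrow> Abs_ell2 f"
  proof (rule metric_LIMSEQ_I)
    fix e :: real assume e: "0 < e"
    obtain M where M: "\<And>m F. m \<ge> M \<Longrightarrow> finite F \<Longrightarrow>
        (\<Sum>i\<in>F. (norm (coord (X m) i - f i))\<^sup>2) \<le> (e / 2)\<^sup>2"
      using bound[of "e / 2"] e by auto
    have "dist (X m) (Abs_ell2 f) < e" if "m \<ge> M" for m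
    proof -
      have "(norm (X m - Abs_ell2 f))\<^sup>2 \<le> (e / 2)\<^sup>2"
        unfolding norm_ell2_sq coord_simps coord_f
        by (rule infsum_le_finite_sums) (use M[OF that] summ in auto)
      then have "norm (X m - Abs_ell2 f) \<le> e / 2"
        using e by (simp add: power2_le_iff_abs_le)
      then show ?thesis
        using e by (simp add: dist_norm)
    qed
    then show "\<exists>M. \<forall>m\<ge>M. dist (X m) (Abs_ell2 f) < e"
      by blast
  qed
  then show "convergent X"
    by (auto simp: convergent_def)
qed

instantiation ell2 :: (type, complex_hilbert) complex_hilbert
begin

lift_definition scaleC_ell2 :: "complex \<Rightarrow> ('a, 'b) ell2 \<Rightarrow> ('a, 'b) ell2" is "\<lambda>a f i. a *\<^sub>C f i"
  unfolding norm_scaleC power_mult_distrib by (rule summable_on_cmult_right)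

definition cinner_ell2 :: "('a, 'b) ell2 \<Rightarrow> ('a, 'b) ell2 \<Rightarrow> complex"
  where "cinner_ell2 x y = (\<Sum>\<^sub>\<infinity>i. cinner (coord x i) (coord y i))"

lemma cinner_summable: "(\<lambda>i. cinner (coord x i) (coord y i)) summable_on UNIV"
  for x y :: "('a, 'b) ell2"
proof -
  have "cinner (coord x i) (coord y i) =
      of_real (inner (coord x i) (coord y i)) + of_real (inner (coord (- \<i> *\<^sub>C x) i) (coord y i)) * \<i>"
    for i
    by (simp add: cinner_eq_inner scaleC_ell2.rep_eq complex_eq_iff)
  moreover have "(\<lambda>i. complex_of_real (inner (coord x i) (coord y i))) summable_on UNIV"
    for x y :: "('a, 'b) ell2"
    by (intro summable_on_of_real inner_summable ell2_summable)
  ultimately show ?thesis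
    by (simp only:) (intro summable_on_add summable_on_cmult_left)
qed

instance
proof
  fix x y z :: "('a, 'b) ell2" and a b :: complex and r :: real
  show "a *\<^sub>C (x + y) = a *\<^sub>C x + a *\<^sub>C y" "(a + b) *\<^sub>C x = a *\<^sub>C x + b *\<^sub>C x"
    "a *\<^sub>C b *\<^sub>C x = (a * b) *\<^sub>C x" "r *\<^sub>R x = complex_of_real r *\<^sub>C x"
    by (transfer; simp add: scaleC_add_right scaleC_add_left scaleC_scaleC scaleR_scaleC; fail)+
  show "cinner x y = cnj (cinner y x)"
    unfolding cinner_ell2_def infsum_cnj[symmetric]
    by (rule infsum_cong) (rule cinner_commute)
  show "cinner (x + y) z = cinner x z + cinner y z"
    unfolding cinner_ell2_def coord_simps cinner_add_left
    by (rule infsum_add) (rule cinner_summable)+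
  show "cinner (a *\<^sub>C x) y = a * cinner x y"
    unfolding cinner_ell2_def scaleC_ell2.rep_eq cinner_scaleC_left
    by (rule infsum_cmult_right) (rule cinner_summable)
  show "inner x y = Re (cinner x y)"
    unfolding cinner_ell2_def inner_ell2_def infsum_Re[OF cinner_summable, symmetric]
    by (rule infsum_cong) (rule inner_eq_Re_cinner)
qed

end

lemma coord_scaleC [simp]: "coord (a *\<^sub>C x) i = a *\<^sub>C coord x i"
  for x :: "('a, 'b::complex_hilbert) ell2"
  by (simp add: scaleC_ell2.rep_eq)


section \<open>The Fock space\<close>

text \<open>
  The \<open>n\<close> letters \<open>1 < \<dots> < n\<close> are the elements of a finite linearly ordered type \<open>'n\<close>, so
  \<open>n = CARD('n) \<ge> 1\<close>; words are lists of letters and the empty word is \<open>[]\<close>.  The space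
  \<open>F\<^sup>2\<^sub>n \<otimes> E\<close> is realised as the square-summable \<open>E\<close>-valued functions on words: the function
  \<open>f\<close> stands for the orthogonal sum of the vectors \<open>e\<^sub>\<mu> \<otimes> f(\<mu>)\<close>.
\<close>

type_synonym ('n, 'e) fock = "('n list, 'e) ell2"

definition first_letter :: "'n::{finite, linorder}"
  where "first_letter = Min UNIV"

definition last_letter :: "'n::{finite, linorder}"
  where "last_letter = Max UNIV"

text \<open>The letter \<open>i + 1\<close>, for \<open>i \<noteq> n\<close>.\<close>

definition next_letter :: "'n::{finite, linorder} \<Rightarrow> 'n"
  where "next_letter i = Min {j. i < j}"

text \<open>The vector \<open>e\<^sub>\<mu> \<otimes> \<eta>\<close>.\<close>

lift_definition basis_tensor :: "'n list \<Rightarrow> 'e::complex_hilbert \<Rightarrow> ('n, 'e) fock"  (infix "\<otimes>\<^sub>e" 70)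
  is "\<lambda>\<mu> \<eta> \<nu>. if \<nu> = \<mu> then \<eta> else 0"
proof -
  fix \<mu> :: "'n list" and \<eta> :: 'e
  have "(\<lambda>\<nu>. (norm (if \<nu> = \<mu> then \<eta> else 0))\<^sup>2) summable_on {\<mu>}"
    by simp
  then show "(\<lambda>\<nu>. (norm (if \<nu> = \<mu> then \<eta> else 0))\<^sup>2) summable_on UNIV"
    by (rule summable_on_cong_neutral[THEN iffD1, rotated -1]) auto
qed

text \<open>The operator \<open>S\<^sub>i \<otimes> I\<^sub>E\<close>.\<close>

lift_definition creation :: "'n \<Rightarrow> ('n, 'e::complex_hilbert) fock \<Rightarrow> ('n, 'e) fock"
  is "\<lambda>i f \<mu>. case \<mu> of [] \<Rightarrow> 0 | j # \<nu> \<Rightarrow> if j = i then f \<nu> else 0"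
proof -
  fix i :: 'n and f :: "'n list \<Rightarrow> 'e"
  let ?g = "\<lambda>\<mu>. (norm (case \<mu> of [] \<Rightarrow> 0 | j # \<nu> \<Rightarrow> if j = i then f \<nu> else 0))\<^sup>2"
  assume "(\<lambda>\<mu>. (norm (f \<mu>))\<^sup>2) summable_on UNIV"
  also have "(\<lambda>\<mu>. (norm (f \<mu>))\<^sup>2) = ?g \<circ> (#) i"
    by auto
  finally have "?g summable_on range ((#) i)"
    by (subst summable_on_reindex) (auto simp: o_def)
  then show "?g summable_on UNIV"
    by (rule summable_on_cong_neutral[THEN iffD1, rotated -1]) (auto split: list.split)
qed

text \<open>\<open>shift1 p f\<close> is \<open>e\<^sub>1\<^sup>p \<otimes> f\<close>.\<close>

definition shift1 :: "nat \<Rightarrow> ('n::{finite, linorder}, 'e::complex_hilbert) fock \<Rightarrow> ('n, 'e) fock"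
  where "shift1 p = creation first_letter ^^ p"

text \<open>
  The value of the odometer map at \<open>e\<^sub>\<mu> \<otimes> \<eta>\<close>.  The words all of whose letters are \<open>n\<close> are
  \<open>n\<^sup>m\<close>, with \<open>m\<close> the length of the word; the case \<open>m = 0\<close> is that of \<open>\<Omega> \<otimes> \<eta>\<close>.  Positions
  in a list are counted from \<open>0\<close>.
\<close>

definition odometer_basis ::
  "('e::complex_hilbert \<Rightarrow> ('n::{finite, linorder}, 'e) fock) \<Rightarrow> 'n list \<Rightarrow> 'e \<Rightarrow> ('n, 'e) fock"
  where "odometer_basis L \<mu> \<eta> =
    (if set \<mu> \<subseteq> {last_letter} then shift1 (length \<mu>) (L \<eta>)
     else let k = (LEAST k. k < length \<mu> \<and> \<mu> ! k \<noteq> last_letter)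
          in (replicate k first_letter @ next_letter (\<mu> ! k) # drop (Suc k) \<mu>) \<otimes>\<^sub>e \<eta>)"

text \<open>
  The odometer map, extended from the vectors \<open>e\<^sub>\<mu> \<otimes> \<eta>\<close> to the whole space by unconditionally
  convergent series.  If it extends to a bounded operator at all, then that
  operator is \<open>odometer L\<close>; see \<open>bounded_clinear_odometer_iff\<close> below.
\<close>

definition odometer ::
  "('e::complex_hilbert \<Rightarrow> ('n::{finite, linorder}, 'e) fock) \<Rightarrow> ('n, 'e) fock \<Rightarrow> ('n, 'e) fock"
  where "odometer L f = (\<Sum>\<^sub>\<infinity>\<mu>. odometer_basis L \<mu> (coord f \<mu>))"

text \<open>The pair consisting of \<open>odometer L\<close> and the creation operators depends on \<open>L\<close> only, and the
  creation operators are always isometries.\<close>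

definition isometric_representation ::
  "('e::complex_hilbert \<Rightarrow> ('n::{finite, linorder}, 'e) fock) \<Rightarrow> bool"
  where "isometric_representation L \<longleftrightarrow> isometry (odometer L)"

definition E_space ::
  "('e::complex_hilbert \<Rightarrow> ('n::{finite, linorder}, 'e) fock) \<Rightarrow> ('n, 'e) fock set"
  where "E_space L =
    closure (cspan {replicate m first_letter \<otimes>\<^sub>e \<eta> | m \<eta>. True})
      \<ominus> closure (cspan {shift1 p (L \<zeta>) | p \<zeta>. 1 \<le> p})"


section \<open>Consistency of the definitions\<close>

lemma coord_basis_tensor: "coord (\<mu> \<otimes>\<^sub>e \<eta>) \<nu> = (if \<nu> = \<mu> then \<eta> else 0)"
  by (simp add: basis_tensor.rep_eq)

lemma cinner_zero [simp]: "cinner 0 y = 0" "cinner y 0 = 0" for y :: "'a::complex_hilbert"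
proof -
  show "cinner 0 y = 0" for y :: 'a
    using cinner_add_left[of 0 0 y] by simp
  then show "cinner y 0 = 0"
    by (subst cinner_commute) simp
qed

lemma cinner_basis_tensor:
  "cinner (\<mu> \<otimes>\<^sub>e \<eta>) (\<nu> \<otimes>\<^sub>e \<zeta>) = (if \<mu> = \<nu> then cinner \<eta> \<zeta> else 0)"
proof -
  have "cinner (\<mu> \<otimes>\<^sub>e \<eta>) (\<nu> \<otimes>\<^sub>e \<zeta>) =
      (\<Sum>\<^sub>\<infinity>i\<in>{\<mu>}. cinner (coord (\<mu> \<otimes>\<^sub>e \<eta>) i) (coord (\<nu> \<otimes>\<^sub>e \<zeta>) i))"
    unfolding cinner_ell2_def by (rule infsum_cong_neutral) (auto simp: coord_basis_tensor)
  then show ?thesis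
    by (simp add: coord_basis_tensor)
qed

lemma creation_basis_tensor: "creation i (\<mu> \<otimes>\<^sub>e \<eta>) = (i # \<mu>) \<otimes>\<^sub>e \<eta>"
  by (rule ell2_eqI) (auto simp: creation.rep_eq coord_basis_tensor split: list.split)

lemma shift1_basis_tensor: "shift1 p (\<mu> \<otimes>\<^sub>e \<eta>) = (replicate p first_letter @ \<mu>) \<otimes>\<^sub>e \<eta>"
  by (induction p) (auto simp: shift1_def creation_basis_tensor)

lemma has_sum_basis_tensor: "((\<lambda>\<mu>. \<mu> \<otimes>\<^sub>e coord x \<mu>) has_sum x) UNIV"
  unfolding has_sum_def
proof (rule tendstoI)
  fix e :: real assume e: "0 < e"
  let ?h = "\<lambda>\<mu>. (norm (coord x \<mu>))\<^sup>2"
  have "(sum ?h \<longlongrightarrow> (norm x)\<^sup>2) (finite_subsets_at_top UNIV)"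
    unfolding norm_ell2_sq by (rule infsum_tendsto) (rule ell2_summable)
  then have "\<forall>\<^sub>F F in finite_subsets_at_top UNIV. dist (sum ?h F) ((norm x)\<^sup>2) < e\<^sup>2"
    using e by (intro tendstoD) auto
  moreover have "\<forall>\<^sub>F F in finite_subsets_at_top UNIV. finite (F :: 'a list set)"
    by (rule eventually_finite_subsets_at_top_weakI)
  ultimately show "\<forall>\<^sub>F F in finite_subsets_at_top UNIV. dist (\<Sum>\<mu>\<in>F. \<mu> \<otimes>\<^sub>e coord x \<mu>) x < e"
  proof eventually_elim
    case (elim F)
    have c: "coord (x - (\<Sum>\<mu>\<in>F. \<mu> \<otimes>\<^sub>e coord x \<mu>)) \<nu> = (if \<nu> \<in> F then 0 else coord x \<nu>)" for \<nu>
      using elim by (simp add: coord_basis_tensor)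
    have "(norm (x - (\<Sum>\<mu>\<in>F. \<mu> \<otimes>\<^sub>e coord x \<mu>)))\<^sup>2 = infsum ?h (UNIV - F)"
      unfolding norm_ell2_sq c by (rule infsum_cong_neutral) auto
    also have "\<dots> = (norm x)\<^sup>2 - sum ?h F"
      using elim by (subst infsum_Diff) (auto simp: norm_ell2_sq ell2_summable)
    also have "\<dots> < e\<^sup>2"
      using elim by (simp add: dist_real_def)
    finally show ?case
      using e by (simp add: dist_norm norm_minus_commute power2_less_imp_less)
  qed
qed

lemma bounded_clinear_bounded_linear: "bounded_clinear T \<Longrightarrow> bounded_linear T"
proof -
  assume "bounded_clinear T"
  then obtain K where T: "clinear T" and K: "\<And>x. norm (T x) \<le> K * norm x"
    by (auto simp: bounded_clinear_def)
  show ?thesis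
  proof (rule bounded_linear_intro)
    interpret T: Vector_Spaces.linear scaleC scaleC T
      by (rule T)
    show "T (x + y) = T x + T y" "T (r *\<^sub>R x) = r *\<^sub>R T x" for x y r
      by (simp_all add: scaleR_scaleC T.add T.scale)
    show "norm (T x) \<le> norm x * K" for x
      using K[of x] by (simp add: mult.commute)
  qed
qed

lemma odometer_basis_zero:
  fixes L :: "'e::complex_hilbert \<Rightarrow> ('n::{finite, linorder}, 'e) fock"
  assumes "bounded_clinear L"
  shows "odometer_basis L \<mu> 0 = 0"
proof -
  interpret L: Vector_Spaces.linear scaleC scaleC L
    using assms by (simp add: bounded_clinear_def)
  have "creation i (0 :: ('n, 'e) fock) = 0" for i :: 'n
    by (rule ell2_eqI) (simp add: creation.rep_eq split: list.split)
  then have "shift1 p (0 :: ('n, 'e) fock) = 0" for p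
    by (induction p) (auto simp: shift1_def)
  moreover have "\<nu> \<otimes>\<^sub>e (0 :: 'e) = 0" for \<nu> :: "'n list"
    by (rule ell2_eqI) (simp add: coord_basis_tensor)
  ultimately show ?thesis
    by (simp add: odometer_basis_def L.zero Let_def)
qed

lemma odometer_basis_tensor:
  assumes "bounded_clinear L"
  shows "odometer L (\<mu> \<otimes>\<^sub>e \<eta>) = odometer_basis L \<mu> \<eta>"
proof -
  have "odometer L (\<mu> \<otimes>\<^sub>e \<eta>) = (\<Sum>\<^sub>\<infinity>\<nu>\<in>{\<mu>}. odometer_basis L \<nu> (coord (\<mu> \<otimes>\<^sub>e \<eta>) \<nu>))"
    unfolding odometer_def
    by (rule infsum_cong_neutral) (auto simp: coord_basis_tensor odometer_basis_zero[OF assms])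
  then show ?thesis
    by (simp add: coord_basis_tensor)
qed

lemma bounded_clinear_odometer_iff:
  assumes "bounded_clinear L"
  shows "bounded_clinear W \<and> (\<forall>\<mu> \<eta>. W (\<mu> \<otimes>\<^sub>e \<eta>) = odometer_basis L \<mu> \<eta>)
    \<longleftrightarrow> W = odometer L \<and> bounded_clinear (odometer L)"
proof
  assume W: "bounded_clinear W \<and> (\<forall>\<mu> \<eta>. W (\<mu> \<otimes>\<^sub>e \<eta>) = odometer_basis L \<mu> \<eta>)"
  have "W x = odometer L x" for x
  proof -
    have "bounded_linear W"
      using W bounded_clinear_bounded_linear by blast
    from has_sum_bounded_linear[OF this has_sum_basis_tensor[of x]]
    have "((\<lambda>\<mu>. odometer_basis L \<mu> (coord x \<mu>)) has_sum W x) UNIV"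
      using W by (simp add: o_def)
    then show ?thesis
      by (simp add: odometer_def infsumI)
  qed
  then show "W = odometer L \<and> bounded_clinear (odometer L)"
    using W by (metis ext)
qed (simp add: odometer_basis_tensor[OF assms])

end

theory Submission
  imports Defs
begin

text \<open>
  An isometry \<open>W\<close> is injective with closed range, and \<open>W\<^sup>* W - W W\<^sup>* = I - W W\<^sup>*\<close> is the orthogonal
  projection onto \<open>ker W\<^sup>*\<close>, which is compact precisely when \<open>ker W\<^sup>*\<close> is finite-dimensional.
  Hence both operator-theoretic conditions say \<open>dim ker W\<^sup>* < \<infinity>\<close>, and the index is
  \<open>- dim ker W\<^sup>*\<close>.  For the odometer map, \<open>ker W\<^sup>*\<close> consists of the vectors supported on the powers
  of the letter \<open>1\<close> that are orthogonal to all \<open>e\<^sub>1\<^sup>m \<otimes> L\<zeta>\<close>, \<open>m \<ge> 0\<close>: the condition for \<open>m \<ge> 1\<close>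
  cuts out \<open>E\<^sub>L\<close>, and that for \<open>m = 0\<close> removes \<open>LE\<close>.
\<close>

section \<open>Projections and complex subspaces\<close>

text \<open>Points of \<open>M\<close> whose squared distance to \<open>y\<close> nearly attains the
  infimum form nested closed sets of shrinking diameter, so completeness yields a nearest point.
  Minimality then makes \<open>y - p\<close> orthogonal to \<open>M\<close>.\<close>

lemma closed_subspace_projection:
  fixes M :: "'a::{real_inner, complete_space} set"
  assumes "closed M" "subspace M"
  obtains p where "p \<in> M" "\<And>z. z \<in> M \<Longrightarrow> inner (y - p) z = 0"
proof -
  let ?d = "infdist y M"
  have "0 \<in> M"
    using assms(2) by (rule subspace_0)
  define S where "S n = M \<inter> {m. (dist y m)\<^sup>2 \<le> ?d\<^sup>2 + inverse (real (Suc n))}" for n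
  have le: "?d\<^sup>2 \<le> (dist y m)\<^sup>2" if "m \<in> M" for m
    using infdist_le[OF that] infdist_nonneg by (intro power_mono)
  have small: "(dist x z)\<^sup>2 \<le> 4 * inverse (real (Suc n))" if "x \<in> S n" "z \<in> S n" for x z n
  proof -
    \<comment> \<open>The midpoint has distance at least \<open>?d\<close> from \<open>y\<close>;
      the parallelogram law for \<open>y - x\<close> and \<open>y - z\<close> turns this into the
      diameter bound.\<close>
    have "(1/2) *\<^sub>R (x + z) \<in> M"
      using that assms(2) by (auto simp: S_def subspace_scale subspace_add)
    from le[OF this] have "4 * ?d\<^sup>2 \<le> (norm (2 *\<^sub>R (y - (1/2) *\<^sub>R (x + z))))\<^sup>2"
      by (simp only: norm_scaleR dist_norm) (simp add: power_mult_distrib)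
    also have "2 *\<^sub>R (y - (1/2) *\<^sub>R (x + z)) = (y - x) + (y - z)"
      by (simp add: algebra_simps scaleR_2)
    finally have "4 * ?d\<^sup>2 \<le> (norm ((y - x) + (y - z)))\<^sup>2" .
    moreover have "(norm ((y - x) + (y - z)))\<^sup>2 + (norm ((y - x) - (y - z)))\<^sup>2
        = 2 * (norm (y - x))\<^sup>2 + 2 * (norm (y - z))\<^sup>2"
      unfolding power2_norm_eq_inner
      by (simp add: inner_add_left inner_add_right inner_diff_left inner_diff_right)
    moreover have "(y - x) - (y - z) = z - x"
      by simp
    ultimately show ?thesis
      using that by (simp add: S_def dist_norm norm_minus_commute[of z])
  qed
  obtain p where p: "\<And>n. p \<in> S n"
  proof (rule decreasing_closed_nest[of S])
    show "closed (S n)" for n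
      unfolding S_def by (intro closed_Int assms(1) closed_Collect_le continuous_intros)
    show "S n \<noteq> {}" for n
    proof -
      have "?d < sqrt (?d\<^sup>2 + inverse (real (Suc n)))"
        by (rule real_less_rsqrt) simp
      moreover have "M \<noteq> {}"
        using \<open>0 \<in> M\<close> by blast
      ultimately have "\<exists>a\<in>dist y ` M. a < sqrt (?d\<^sup>2 + inverse (real (Suc n)))"
        unfolding infdist_notempty[OF \<open>M \<noteq> {}\<close>] by (intro cInf_lessD) auto
      then obtain m where "m \<in> M" "dist y m < sqrt (?d\<^sup>2 + inverse (real (Suc n)))"
        by blast
      moreover have "0 \<le> ?d\<^sup>2 + inverse (real (Suc n))"
        by (intro add_nonneg_nonneg) auto
      ultimately have "m \<in> S n"
        using power_mono[of "dist y m" "sqrt (?d\<^sup>2 + inverse (real (Suc n)))" 2]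
        by (auto simp: S_def simp del: of_nat_Suc)
      then show ?thesis by blast
    qed
    show "S n \<subseteq> S m" if "m \<le> n" for m n
    proof -
      have "inverse (real (Suc n)) \<le> inverse (real (Suc m))"
        using that by (intro le_imp_inverse_le) auto
      then show ?thesis
        unfolding S_def by (intro Int_mono[OF subset_refl] Collect_mono impI) linarith
    qed
    show "\<exists>n. \<forall>x\<in>S n. \<forall>z\<in>S n. dist x z < \<epsilon>" if "\<epsilon> > 0" for \<epsilon>
    proof -
      obtain n where "inverse (real (Suc n)) < \<epsilon>\<^sup>2 / 4"
        using reals_Archimedean[of "\<epsilon>\<^sup>2 / 4"] \<open>\<epsilon> > 0\<close> by auto
      then have "(dist x z)\<^sup>2 < \<epsilon>\<^sup>2" if "x \<in> S n" "z \<in> S n" for x z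
        using small[OF that] by simp
      then show ?thesis
        using power2_less_imp_less \<open>\<epsilon> > 0\<close> less_imp_le by blast
    qed
  qed (rule that, blast)
  have "p \<in> M"
    using p by (auto simp: S_def)
  have "(dist y p)\<^sup>2 - ?d\<^sup>2 \<le> 0"
  proof (rule field_le_epsilon)
    fix e :: real assume "0 < e"
    then obtain n where "inverse (real (Suc n)) < e"
      using reals_Archimedean by blast
    then show "(dist y p)\<^sup>2 - ?d\<^sup>2 \<le> 0 + e"
      using p[of n] by (simp add: S_def)
  qed
  then have "dist y p \<le> ?d"
    using infdist_nonneg power2_le_imp_le by fastforce
  then have min: "\<forall>z\<in>M. dist y p \<le> dist y z"
    using infdist_le order_trans by blast
  have dot: "inner (y - p) (z - p) \<le> 0" if "z \<in> M" for z
    using any_closest_point_dot[OF subspace_imp_convex[OF assms(2)] assms(1) \<open>p \<in> M\<close> that min] .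
  \<comment> \<open>Minimality only gives an inequality; testing it at \<open>p + z\<close> and
    \<open>p - z\<close> gives both signs.\<close>
  have "inner (y - p) z = 0" if "z \<in> M" for z
    using dot[of "p + z"] dot[of "p - z"] \<open>p \<in> M\<close> that assms(2)
    by (auto simp: subspace_add subspace_diff)
  then show thesis
    using that \<open>p \<in> M\<close> by blast
qed

section \<open>Rules for the sesquilinear form; real and complex spans\<close>

lemma cinner_add_right: "cinner x (y + z) = cinner x y + cinner x z"
  for x :: "'a::complex_hilbert"
  by (metis cinner_add_left cinner_commute complex_cnj_add)

lemma cinner_scaleC_right: "cinner x (a *\<^sub>C y) = cnj a * cinner x y"
  for x :: "'a::complex_hilbert"
  by (metis cinner_commute cinner_scaleC_left complex_cnj_mult)

lemma cinner_diff_right: "cinner x (y - z) = cinner x y - cinner x z"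
  for x :: "'a::complex_hilbert"
  using cinner_add_right[of x "y - z" z] by simp

lemma cinner_eq_zero_commute: "cinner x y = 0 \<longleftrightarrow> cinner y x = 0" for x :: "'a::complex_hilbert"
  by (metis cinner_commute complex_cnj_zero)

lemma cinner_self_eq_zero: "cinner x x = 0 \<longleftrightarrow> x = 0" for x :: "'a::complex_hilbert"
  by (metis cinner_zero(1) inner_eq_Re_cinner inner_eq_zero_iff zero_complex.simps(1))

lemma cinner_extensionality:
  fixes x y :: "'a::complex_hilbert"
  assumes "\<And>z. cinner z x = cinner z y"
  shows "x = y"
  using assms[of "x - y"] cinner_diff_right[of "x - y" x y] by (simp add: cinner_self_eq_zero)

lemma csubspace_imp_subspace: "complex_vector.subspace V \<Longrightarrow> subspace V"
  by (simp add: complex_vector.subspace_def subspace_def scaleR_scaleC)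

lemma span_subset_cspan: "span B \<subseteq> cspan B"
  by (intro span_minimal complex_vector.span_superset csubspace_imp_subspace
      complex_vector.subspace_span)

text \<open>A complex multiple of \<open>x\<close> is a real combination of \<open>x\<close> and
  \<open>\<i> *\<^sub>C x\<close>, so doubling the generating set suffices.\<close>

lemma cspan_subset_span: "cspan B \<subseteq> span (B \<union> scaleC \<i> ` B)"
proof
  fix x assume "x \<in> cspan B"
  then show "x \<in> span (B \<union> scaleC \<i> ` B)"
  proof (induction rule: complex_vector.span_induct_alt)
    case (step c x y)
    have "c *\<^sub>C x = Re c *\<^sub>R x + Im c *\<^sub>R (\<i> *\<^sub>C x)"
      unfolding scaleR_scaleC scaleC_scaleC scaleC_add_left[symmetric]
      by (simp add: complex_eq mult.commute)
    moreover have "Re c *\<^sub>R x + Im c *\<^sub>R (\<i> *\<^sub>C x) \<in> span (B \<union> scaleC \<i> ` B)"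
      using step by (intro span_add span_scale span_base) auto
    ultimately show ?case
      using step by (simp add: span_add)
  qed (rule span_zero)
qed

text \<open>Finiteness is the same over real and complex scalars, so real orthogonalization and
  compactness arguments apply to complex kernels.\<close>

lemma finite_cdim_iff_span: "finite_cdim V \<longleftrightarrow> (\<exists>B. finite B \<and> V \<subseteq> span B)"
proof
  assume "finite_cdim V"
  then obtain B where "finite B" "V \<subseteq> cspan B"
    unfolding finite_cdim_def by blast
  then have "finite (B \<union> scaleC \<i> ` B)" "V \<subseteq> span (B \<union> scaleC \<i> ` B)"
    using cspan_subset_span[of B] by auto
  then show "\<exists>B. finite B \<and> V \<subseteq> span B"
    by blast
next
  assume "\<exists>B. finite B \<and> V \<subseteq> span B"
  then show "finite_cdim V"
    unfolding finite_cdim_def using span_subset_cspan by (metis order_trans)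
qed

text \<open>The complement of a set is a closed complex subspace, so orthogonality to a set extends to
  its closed complex span.\<close>

lemma cinner_closure_cspan:
  fixes y :: "'a::complex_hilbert"
  assumes "\<And>x. x \<in> A \<Longrightarrow> cinner y x = 0" and "x \<in> closure (cspan A)"
  shows "cinner y x = 0"
proof -
  have "complex_vector.subspace {x. cinner y x = 0}"
    by (rule complex_vector.subspaceI) (simp_all add: cinner_add_right cinner_scaleC_right)
  then have "cspan A \<subseteq> {x. cinner y x = 0}"
    using assms(1) by (intro complex_vector.span_minimal) auto
  \<comment> \<open>Real and imaginary parts split the condition into two equations between
    continuous real functions.\<close>
  moreover have "{x. cinner y x = 0} = {x. inner x y = 0 \<and> inner x (- \<i> *\<^sub>C y) = 0}"
    by (auto simp: complex_eq_iff cinner_eq_inner inner_commute)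
  then have "closed {x. cinner y x = 0}"
    by (simp only:) (intro closed_Collect_conj closed_Collect_eq continuous_intros)
  ultimately show ?thesis
    using assms(2) closure_minimal by blast
qed


section \<open>Compactness in finite-dimensional subspaces\<close>

text \<open>The sum is the orthogonal projection of \<open>x\<close> onto \<open>span C\<close>. The
  members of \<open>C\<close> are not normalized, hence the divisors; a zero vector in
  \<open>C\<close> contributes 0.\<close>

lemma orthogonal_sum_projection:
  fixes C :: "'a::real_inner set"
  assumes "finite C" "pairwise orthogonal C" "z \<in> span C"
  shows "inner (x - (\<Sum>c\<in>C. (inner x c / inner c c) *\<^sub>R c)) z = 0"
  using assms(3)
proof (induction rule: span_induct_alt)
  case (step a z y)
  \<comment> \<open>Orthogonality leaves only the term of the generator \<open>z\<close>
    itself.\<close>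
  have "(\<Sum>c\<in>C. (inner x c / inner c c) * inner c z) = (\<Sum>c\<in>{z}. (inner x c / inner c c) * inner c z)"
    using assms(1,2) step(1)
    by (intro sum.mono_neutral_right) (auto simp: pairwise_def orthogonal_def)
  then have "inner (x - (\<Sum>c\<in>C. (inner x c / inner c c) *\<^sub>R c)) z = 0"
    by (simp add: inner_diff_left inner_sum_left)
  with step show ?case
    by (simp add: inner_add_right)
qed simp

text \<open>By induction on \<open>C\<close>: a further vector \<open>d\<close> turns the set into a
  continuous image of a compact interval times the earlier set.\<close>

lemma compact_box_combinations:
  fixes C :: "'a::real_normed_vector set"
  assumes "finite C"
  shows "compact {\<Sum>c\<in>C. t c *\<^sub>R c | t. \<forall>c\<in>C. \<bar>t c\<bar> \<le> r c}"
  using assms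
proof (induction rule: finite_induct)
  case (insert d C)
  let ?S = "{\<Sum>c\<in>C. t c *\<^sub>R c | t. \<forall>c\<in>C. \<bar>t c\<bar> \<le> r c}"
  have "{\<Sum>c\<in>insert d C. t c *\<^sub>R c | t. \<forall>c\<in>insert d C. \<bar>t c\<bar> \<le> r c}
      = (\<lambda>(s, v). s *\<^sub>R d + v) ` ({- r d..r d} \<times> ?S)" (is "?A = ?B")
  proof
    show "?A \<subseteq> ?B"
    proof
      fix x assume "x \<in> ?A"
      then obtain t where t: "\<forall>c\<in>insert d C. \<bar>t c\<bar> \<le> r c" "x = (\<Sum>c\<in>insert d C. t c *\<^sub>R c)"
        by blast
      then have "(t d, \<Sum>c\<in>C. t c *\<^sub>R c) \<in> {- r d..r d} \<times> ?S"
        by (auto simp: abs_le_iff)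
      moreover have "x = (\<lambda>(s, v). s *\<^sub>R d + v) (t d, \<Sum>c\<in>C. t c *\<^sub>R c)"
        using t insert.hyps by simp
      ultimately show "x \<in> ?B"
        by (rule rev_image_eqI)
    qed
    show "?B \<subseteq> ?A"
    proof clarify
      fix s t assume s: "s \<in> {- r d..r d}" and t: "\<forall>c\<in>C. \<bar>t c\<bar> \<le> r c"
      have "(\<Sum>c\<in>C. (t(d := s)) c *\<^sub>R c) = (\<Sum>c\<in>C. t c *\<^sub>R c)"
        using insert.hyps by (intro sum.cong) auto
      then have "s *\<^sub>R d + (\<Sum>c\<in>C. t c *\<^sub>R c) = (\<Sum>c\<in>insert d C. (t(d := s)) c *\<^sub>R c)"
        using insert.hyps by simp
      moreover have "\<forall>c\<in>insert d C. \<bar>(t(d := s)) c\<bar> \<le> r c"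
        using s t by (auto simp: abs_le_iff)
      ultimately show "\<exists>u. s *\<^sub>R d + (\<Sum>c\<in>C. t c *\<^sub>R c) = (\<Sum>c\<in>insert d C. u c *\<^sub>R c)
          \<and> (\<forall>c\<in>insert d C. \<bar>u c\<bar> \<le> r c)"
        by blast
    qed
  qed
  moreover have "compact ?B"
    using insert.IH
    by (intro compact_continuous_image compact_Times compact_Icc)
      (auto simp: case_prod_unfold intro!: continuous_intros)
  ultimately show ?case
    by simp
qed simp

text \<open>For an orthogonal generating set, Cauchy-Schwarz bounds the coefficients of vectors in
  the unit ball, so \<open>S\<close> lies in a compact box of combinations.\<close>

lemma compact_closure_bounded_span:
  fixes S :: "'a::real_inner set"
  assumes "finite B" "S \<subseteq> span B" "S \<subseteq> cball 0 1"
  shows "compact (closure S)"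
proof -
  obtain C where C: "finite C" "span C = span B" "pairwise orthogonal C"
    using basis_orthogonal[OF assms(1)] by blast
  let ?K = "{\<Sum>c\<in>C. t c *\<^sub>R c | t. \<forall>c\<in>C. \<bar>t c\<bar> \<le> norm c / inner c c}"
  have "x \<in> ?K" if "x \<in> S" for x
  proof -
    let ?p = "\<Sum>c\<in>C. (inner x c / inner c c) *\<^sub>R c"
    have "x - ?p \<in> span C"
      using that assms(2) C(2)
      by (metis (no_types, lifting) span_base span_diff span_scale span_sum subsetD)
    \<comment> \<open>The difference lies in \<open>span C\<close> and is orthogonal to it, hence to
      itself.\<close>
    from orthogonal_sum_projection[OF C(1,3) this, of x] have "x = ?p"
      by simp
    moreover have "\<bar>inner x c / inner c c\<bar> \<le> norm c / inner c c" for c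
    proof -
      have "\<bar>inner x c\<bar> \<le> norm x * norm c"
        by (rule Cauchy_Schwarz_ineq2)
      also have "\<dots> \<le> norm c"
        using that assms(3) by (intro mult_left_le_one_le) auto
      finally show ?thesis
        by (simp add: abs_divide divide_right_mono)
    qed
    ultimately show ?thesis
      by (intro CollectI exI[of _ "\<lambda>c. inner x c / inner c c"] conjI ballI)
  qed
  then have "S \<subseteq> ?K"
    by blast
  moreover have "compact ?K"
    using C(1) by (rule compact_box_combinations)
  ultimately have "compact (?K \<inter> closure S)" "closure S \<subseteq> ?K"
    by (simp_all only: compact_Int_closed closed_closure closure_minimal compact_imp_closed)
  then show ?thesis
    by (simp only: Int_absorb1)
qed

text \<open>Riesz's argument: the centres of a finite cover of \<open>K\<close> by unit balls span
  \<open>V\<close>, since a unit vector of \<open>V\<close> orthogonal to all centres would escape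
  the cover. \<open>K\<close> is a set between the unit ball and \<open>V\<close> because it will be
  the closure of a projected ball.\<close>

lemma span_of_compact_unit_ball:
  fixes V :: "'a::real_inner set"
  assumes "subspace V" "compact K" "V \<inter> cball 0 1 \<subseteq> K" "K \<subseteq> V"
  obtains B where "finite B" "V \<subseteq> span B"
proof -
  obtain F where F: "finite F" "F \<subseteq> K" "K \<subseteq> (\<Union>f\<in>F. ball f 1)"
    using seq_compact_imp_totally_bounded[of K] compact_imp_seq_compact[OF assms(2)] zero_less_one
    by metis
  obtain C where C: "finite C" "span C = span F" "pairwise orthogonal C"
    using basis_orthogonal[OF F(1)] by blast
  have "x \<in> span F" if "x \<in> V" for x
  proof (rule ccontr)
    assume "x \<notin> span F"
    define w where "w = x - (\<Sum>c\<in>C. (inner x c / inner c c) *\<^sub>R c)"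
    have sum_span: "(\<Sum>c\<in>C. (inner x c / inner c c) *\<^sub>R c) \<in> span F"
      using C(2) by (metis (no_types, lifting) span_base span_scale span_sum)
    then have "w \<noteq> 0"
      using \<open>x \<notin> span F\<close> by (auto simp: w_def)
    have "span F \<subseteq> V"
      using F(2) assms(1,4) by (intro span_minimal) auto
    with sum_span have "w \<in> V"
      using that assms(1) by (auto simp: w_def intro: subspace_diff)
    have "w /\<^sub>R norm w \<in> V \<inter> cball 0 1"
      using \<open>w \<in> V\<close> \<open>w \<noteq> 0\<close> assms(1) by (auto simp: subspace_scale)
    then obtain f where f: "f \<in> F" "dist f (w /\<^sub>R norm w) < 1"
      using assms(3) F(3) by force
    have "inner w f = 0"
      unfolding w_def using f(1) C by (intro orthogonal_sum_projection) (auto intro: span_base)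
    \<comment> \<open>Pythagoras: the normalized \<open>w\<close> is orthogonal to \<open>f\<close>,
      so it lies at distance at least 1 from it.\<close>
    then have "(norm (f - w /\<^sub>R norm w))\<^sup>2 = (norm f)\<^sup>2 + 1"
      using \<open>w \<noteq> 0\<close> unfolding power2_norm_eq_inner inner_diff_left inner_diff_right
      by (simp add: inner_commute[of f w] dot_square_norm field_simps power2_eq_square)
    moreover have "(norm (f - w /\<^sub>R norm w))\<^sup>2 < 1"
      using f(2) by (simp add: dist_norm abs_square_less_1)
    ultimately show False
      by (metis add_increasing not_less order_refl zero_le_power2)
  qed
  then show thesis
    using that F(1) by blast
qed


section \<open>Isometries\<close>

text \<open>\<open>cadjoint\<close> is defined by choice, so its characteristic identity is
  available only once some adjoint \<open>S\<close> has been exhibited.\<close>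

lemma has_adjoint_cadjoint:
  assumes "\<And>x y. cinner (T x) y = cinner x (S y)"
  shows "cinner (T x) y = cinner x (cadjoint T y)"
proof -
  have "\<forall>x y. cinner (T x) y = cinner x (cadjoint T y)"
    unfolding cadjoint_def by (rule someI[of _ S]) (use assms in blast)
  then show ?thesis by blast
qed

lemma clinearI:
  fixes T :: "'a::complex_hilbert \<Rightarrow> 'b::complex_hilbert"
  assumes "\<And>x y. T (x + y) = T x + T y" "\<And>a x. T (a *\<^sub>C x) = a *\<^sub>C T x"
  shows "clinear T"
  by (simp add: Vector_Spaces.linear_iff assms complex_vector.vector_space_axioms)

locale isometric_operator =
  fixes T :: "'a::complex_hilbert \<Rightarrow> 'b::complex_hilbert"
  assumes isometry: "isometry T"
begin

lemma bounded_clinear: "bounded_clinear T"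
  using isometry by (simp add: isometry_def)

lemma clinear: "clinear T"
  using bounded_clinear by (simp add: bounded_clinear_def)

sublocale T: Vector_Spaces.linear scaleC scaleC T
  by (rule clinear)

lemma bounded_linear: "bounded_linear T"
  using bounded_clinear by (rule bounded_clinear_bounded_linear)

lemma norm_eq: "norm (T x) = norm x"
  using isometry by (simp add: isometry_def)

text \<open>Polarization: norms of sums recover the real inner product, and replacing
  \<open>x\<close> by \<open>- \<i> *\<^sub>C x\<close> recovers the imaginary part.\<close>

lemma cinner_eq: "cinner (T x) (T y) = cinner x y"
proof -
  have inner: "inner (T x) (T y) = inner x y" for x y
    using norm_eq[of "x + y"] norm_eq[of x] norm_eq[of y]
    by (simp add: T.add norm_eq inner_add_left inner_add_right
        norm_eq_sqrt_inner inner_commute)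
  have "inner (- \<i> *\<^sub>C T x) (T y) = inner (- \<i> *\<^sub>C x) y"
    unfolding T.scale[symmetric] by (rule inner)
  then show ?thesis
    by (simp add: cinner_eq_inner inner)
qed

lemma ker_eq: "ker T = {0}"
  using norm_eq T.zero unfolding ker_def
  by (metis (mono_tags, lifting) Collect_cong norm_eq_zero singleton_conv)

lemma closed_range: "closed (range T)"
proof -
  have "complete (range T)"
    by (rule complete_isometric_image[of 1])
      (use norm_eq complete_UNIV bounded_linear in \<open>auto\<close>)
  then show ?thesis
    by (rule complete_imp_closed)
qed

lemma csubspace_range: "complex_vector.subspace (range T)"
  using T.subspace_image[OF complex_vector.subspace_UNIV] .

text \<open>An adjoint exists because the range is closed: project \<open>y\<close> onto it and take
  the preimage \<open>s\<close> of the projection; \<open>T\<close> preserves inner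
  products.\<close>

lemma cinner_cadjoint: "cinner (T x) y = cinner x (cadjoint T y)"
proof -
  have "\<exists>s. \<forall>x. cinner (T x) y = cinner x s" for y
  proof -
    obtain p where p: "p \<in> range T" "\<And>z. z \<in> range T \<Longrightarrow> inner (y - p) z = 0"
      using closed_subspace_projection[OF closed_range csubspace_imp_subspace[OF csubspace_range]]
      by blast
    obtain s where s: "p = T s"
      using p(1) by blast
    have "cinner (T x) (y - p) = 0" for x
    proof -
      \<comment> \<open>The range is invariant under multiplication by \<open>- \<i>\<close>, so
        real orthogonality to it also makes the imaginary part vanish.\<close>
      have "inner (y - p) (- \<i> *\<^sub>C T x) = 0"
        using p(2)[OF rangeI, of "- \<i> *\<^sub>C x"] by (simp only: T.scale)
      with p(2)[OF rangeI, of x] show ?thesis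
        by (simp add: cinner_eq_inner inner_commute complex_eq_iff)
    qed
    then have "cinner (T x) y = cinner x s" for x
      using cinner_eq[of x s] by (simp add: s cinner_diff_right)
    then show ?thesis by blast
  qed
  then obtain S where "\<And>x y. cinner (T x) y = cinner x (S y)"
    by metis
  then show ?thesis
    by (rule has_adjoint_cadjoint)
qed

section \<open>The adjoint of an isometry and the defect projection\<close>

lemma cadjoint_apply: "cadjoint T (T x) = x"
  by (rule cinner_extensionality) (simp add: cinner_cadjoint[symmetric] cinner_eq)

lemma clinear_cadjoint: "clinear (cadjoint T)"
proof (rule clinearI)
  show "cadjoint T (x + y) = cadjoint T x + cadjoint T y" for x y
    by (rule cinner_extensionality) (simp add: cinner_cadjoint[symmetric] cinner_add_right)
  show "cadjoint T (a *\<^sub>C x) = a *\<^sub>C cadjoint T x" for a x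
    by (rule cinner_extensionality) (simp add: cinner_cadjoint[symmetric] cinner_scaleC_right)
qed

sublocale adj: Vector_Spaces.linear scaleC scaleC "cadjoint T"
  by (rule clinear_cadjoint)

lemma ker_cadjoint: "ker (cadjoint T) = {y. \<forall>x. cinner (T x) y = 0}"
  unfolding ker_def cinner_cadjoint using cinner_extensionality[of _ 0] by auto

abbreviation defect :: "'b \<Rightarrow> 'b"
  where "defect y \<equiv> y - T (cadjoint T y)"

lemma defect_in_ker: "defect y \<in> ker (cadjoint T)"
  by (simp add: ker_def adj.diff cadjoint_apply)

text \<open>An isometry is injective, so \<open>T (cadjoint T y) = 0\<close> forces
  \<open>cadjoint T y = 0\<close>. As a fixed-point set, the kernel is closed by continuity of
  \<open>defect\<close>.\<close>

lemma ker_cadjoint_eq_fixpoints: "ker (cadjoint T) = {y. defect y = y}"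
proof -
  have "defect y = y \<longleftrightarrow> cadjoint T y = 0" for y
    using norm_eq[of "cadjoint T y"] by (simp add: diff_eq_eq) (metis norm_eq_zero)
  then show ?thesis
    by (simp add: ker_def)
qed

text \<open>Pythagoras for the orthogonal decomposition of \<open>y\<close> into
  \<open>defect y\<close> and \<open>T (cadjoint T y)\<close>.\<close>

lemma norm_defect_le: "norm (defect y) \<le> norm y"
proof -
  have "cinner (T (cadjoint T y)) (defect y) = 0"
    using defect_in_ker ker_cadjoint by blast
  then have "inner (T (cadjoint T y)) (defect y) = 0"
    by (simp add: inner_eq_Re_cinner)
  then have "inner y y = inner (defect y) (defect y) + inner (T (cadjoint T y)) (T (cadjoint T y))"
    by (simp add: inner_diff_left inner_diff_right inner_commute)
  then have "inner (defect y) (defect y) \<le> inner y y"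
    by simp
  then show ?thesis
    by (simp add: norm_eq_sqrt_inner)
qed

lemma bounded_clinear_defect: "bounded_clinear defect"
  unfolding bounded_clinear_def
proof
  show "clinear defect"
    by (rule clinearI) (simp_all add: adj.add adj.scale T.add T.scale
        complex_vector.scale_right_diff_distrib)
  show "\<exists>K. \<forall>y. norm (defect y) \<le> K * norm y"
    using norm_defect_le by (intro exI[of _ 1]) simp
qed

text \<open>The closed image of the unit ball lies between the unit ball of the kernel and the
  kernel, so its compactness forces finite dimension. Conversely, that image is the closure of a
  bounded subset of a finite-dimensional space.\<close>

lemma compact_defect_iff: "compact_operator defect \<longleftrightarrow> finite_cdim (ker (cadjoint T))"
proof
  assume compact: "compact_operator defect"
  have ball: "ker (cadjoint T) \<inter> cball 0 1 \<subseteq> closure (defect ` cball 0 1)"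
  proof
    fix y assume "y \<in> ker (cadjoint T) \<inter> cball 0 1"
    then have fix_y: "defect y = y" and "y \<in> cball 0 1"
      by (auto simp: ker_cadjoint_eq_fixpoints)
    then have "defect y \<in> closure (defect ` cball 0 1)"
      by (intro subsetD[OF closure_subset] imageI)
    then show "y \<in> closure (defect ` cball 0 1)"
      by (simp only: fix_y)
  qed
  have "continuous_on UNIV defect"
    using bounded_clinear_bounded_linear[OF bounded_clinear_defect]
    by (rule linear_continuous_on)
  then have "closed (ker (cadjoint T))"
    unfolding ker_cadjoint_eq_fixpoints by (intro closed_Collect_eq continuous_on_id)
  then have "closure (defect ` cball 0 1) \<subseteq> ker (cadjoint T)"
    using defect_in_ker by (intro closure_minimal) auto
  moreover have "complex_vector.subspace (ker (cadjoint T))"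
    unfolding ker_def by (rule adj.subspace_kernel)
  ultimately obtain B where "finite B" "ker (cadjoint T) \<subseteq> span B"
    using span_of_compact_unit_ball[OF csubspace_imp_subspace _ ball] compact
    unfolding compact_operator_def by blast
  then show "finite_cdim (ker (cadjoint T))"
    unfolding finite_cdim_iff_span by blast
next
  assume "finite_cdim (ker (cadjoint T))"
  then obtain B where "finite B" "ker (cadjoint T) \<subseteq> span B"
    unfolding finite_cdim_iff_span by blast
  moreover have "defect ` cball 0 1 \<subseteq> cball 0 1"
    using norm_defect_le order_trans by fastforce
  ultimately have "compact (closure (defect ` cball 0 1))"
    using defect_in_ker by (intro compact_closure_bounded_span[of B]) auto
  then show "compact_operator defect"
    by (simp add: compact_operator_def bounded_clinear_defect)
qed

lemma fredholm_iff: "fredholm T \<longleftrightarrow> finite_cdim (ker (cadjoint T))"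
proof -
  have "finite_cdim (ker T)"
    unfolding ker_eq finite_cdim_def by (intro exI[of _ "{0}"]) (auto intro: complex_vector.span_base)
  then show ?thesis
    by (simp add: fredholm_def bounded_clinear closed_range)
qed

lemma fredholm_index_eq: "fredholm_index T = - int (cdim (ker (cadjoint T)))"
proof -
  \<comment> \<open>This 0 is a true dimension, witnessed by the empty basis, and not the default
    value for infinite dimension.\<close>
  have "cdim (ker T) = 0"
    unfolding ker_eq by (rule complex_vector.dim_unique[of "{}"])
      (simp_all add: complex_vector.span_empty complex_vector.independent_empty)
  then show ?thesis
    by (simp add: fredholm_index_def)
qed

end

lemma isometry_essentially_normal_iff:
  assumes "isometry T"
  shows "essentially_normal T \<longleftrightarrow> finite_cdim (ker (cadjoint T))"
proof -
  interpret isometric_operator T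
    using assms by unfold_locales
  \<comment> \<open>By \<open>cadjoint_apply\<close> the commutator in the definition is exactly
    \<open>defect\<close>.\<close>
  show ?thesis
    using compact_defect_iff by (simp add: essentially_normal_def bounded_clinear cadjoint_apply)
qed


section \<open>The odometer map\<close>

text \<open>Taking \<open>\<eta> = coord f \<mu>\<close> makes the value a squared norm; below,
  coordinates are shown to vanish in this way.\<close>

lemma cinner_basis_tensor_left: "cinner (\<mu> \<otimes>\<^sub>e \<eta>) f = cinner \<eta> (coord f \<mu>)"
proof -
  have "cinner (\<mu> \<otimes>\<^sub>e \<eta>) f = (\<Sum>\<^sub>\<infinity>\<nu>\<in>{\<mu>}. cinner (coord (\<mu> \<otimes>\<^sub>e \<eta>) \<nu>) (coord f \<nu>))"
    unfolding cinner_ell2_def by (rule infsum_cong_neutral) (auto simp: coord_basis_tensor)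
  then show ?thesis
    by (simp add: coord_basis_tensor)
qed

text \<open>Applied with the last letter to arguments of the odometer map, and with the first letter
  to recognize powers of that letter.\<close>

lemma words_split:
  obtains m where "\<mu> = replicate m a"
  | k i \<rho> where "\<mu> = replicate k a @ i # \<rho>" "i \<noteq> a"
proof (cases "set \<mu> \<subseteq> {a}")
  case True
  then have "\<mu> = replicate (length \<mu>) a"
    by (intro replicate_eqI) auto
  then show thesis
    by (rule that(1))
next
  case False
  then have "\<exists>x\<in>set \<mu>. x \<noteq> a"
    by blast
  from split_list_first_prop[OF this] obtain \<sigma> i \<rho>
    where \<sigma>: "\<mu> = \<sigma> @ i # \<rho>" "i \<noteq> a" "\<forall>y\<in>set \<sigma>. y = a"
    by blast
  then have "\<sigma> = replicate (length \<sigma>) a"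
    by (intro replicate_eqI) auto
  then show thesis
    using that(2) \<sigma> by metis
qed

text \<open>The hypothesis makes the set under \<open>Min\<close> nonempty: it contains
  \<open>last_letter\<close>.\<close>

lemma next_letter_less: "i \<noteq> last_letter \<Longrightarrow> i < next_letter i"
  for i :: "'n::{finite, linorder}"
proof -
  assume "i \<noteq> last_letter"
  then have "i < last_letter"
    unfolding last_letter_def by (simp add: order.not_eq_order_implies_strict)
  then have "next_letter i \<in> {j. i < j}"
    unfolding next_letter_def by (intro Min_in) auto
  then show ?thesis
    by simp
qed

lemma first_letter_le: "first_letter \<le> i" for i :: "'n::{finite, linorder}"
  by (simp add: first_letter_def)

text \<open>The preimage is the greatest letter below \<open>j\<close>; no letter lies strictly
  between the two.\<close>

lemma next_letter_surj:
  fixes j :: "'n::{finite, linorder}"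
  assumes "j \<noteq> first_letter"
  obtains i where "i \<noteq> last_letter" "next_letter i = j"
proof -
  define i where "i = Max {i. i < j}"
  have "first_letter \<in> {i. i < j}"
    using assms first_letter_le[of j] by auto
  then have "i \<in> {i. i < j}"
    unfolding i_def by (intro Max_in) auto
  then have "i < j"
    by simp
  have "next_letter i = j"
    unfolding next_letter_def
  proof (rule Min_eqI)
    show "j \<le> k" if "k \<in> {k. i < k}" for k
    proof (rule ccontr)
      assume "\<not> j \<le> k"
      then have "k \<le> i"
        unfolding i_def by (intro Max_ge) auto
      with that show False by simp
    qed
  qed (use \<open>i < j\<close> in auto)
  moreover have "i \<noteq> last_letter"
    using \<open>i < j\<close> by (metis Max_ge UNIV_I finite last_letter_def not_le)
  ultimately show thesis
    using that by blast
qed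

section \<open>The odometer map on basis vectors and its defect space\<close>

lemma odometer_basis_replicate:
  "odometer_basis L (replicate m last_letter) \<eta> = shift1 m (L \<eta>)"
  by (auto simp: odometer_basis_def)

lemma odometer_basis_carry:
  assumes "i \<noteq> last_letter"
  shows "odometer_basis L (replicate k last_letter @ i # \<rho>) \<eta>
    = (replicate k first_letter @ next_letter i # \<rho>) \<otimes>\<^sub>e \<eta>"
proof -
  let ?\<mu> = "replicate k last_letter @ i # \<rho>"
  \<comment> \<open>Positions start at 0, so the first letter other than the last one sits at the
    length \<open>k\<close> of the leading block.\<close>
  have "(LEAST k. k < length ?\<mu> \<and> ?\<mu> ! k \<noteq> last_letter) = k"
  proof (rule Least_equality)
    show "k < length ?\<mu> \<and> ?\<mu> ! k \<noteq> last_letter"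
      using assms by (simp add: nth_append)
    show "k \<le> l" if "l < length ?\<mu> \<and> ?\<mu> ! l \<noteq> last_letter" for l
      using that by (metis length_replicate not_le nth_append nth_replicate)
  qed
  moreover have "\<not> set ?\<mu> \<subseteq> {last_letter}"
    using assms by auto
  moreover have "?\<mu> ! k = i" "drop (Suc k) ?\<mu> = \<rho>"
    by (simp_all add: nth_append)
  ultimately show ?thesis
    by (simp only: odometer_basis_def Let_def if_False)
qed

text \<open>The words with a letter different from \<open>1\<close> are exactly the images of those with a letter
  different from \<open>n\<close>.\<close>

lemma orthogonal_odometer_basis_iff:
  fixes L :: "'e::complex_hilbert \<Rightarrow> ('n::{finite, linorder}, 'e) fock"
  shows "(\<forall>\<mu> \<eta>. cinner (odometer_basis L \<mu> \<eta>) f = 0) \<longleftrightarrow>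
    (\<forall>k j \<rho>. j \<noteq> first_letter \<longrightarrow> coord f (replicate k first_letter @ j # \<rho>) = 0)
    \<and> (\<forall>m \<eta>. cinner (shift1 m (L \<eta>)) f = 0)" (is "?A \<longleftrightarrow> ?B \<and> ?C")
proof (intro iffI conjI)
  assume A: ?A
  show ?B
  proof (intro allI impI)
    fix k \<rho> and j :: 'n
    assume "j \<noteq> first_letter"
    then obtain i where i: "i \<noteq> last_letter" "next_letter i = j"
      by (rule next_letter_surj)
    let ?\<nu> = "replicate k first_letter @ j # \<rho>"
    \<comment> \<open>This basis vector is the odometer value at the word with leading letters
      \<open>last_letter\<close> followed by \<open>i\<close>.\<close>
    have "cinner (?\<nu> \<otimes>\<^sub>e coord f ?\<nu>) f = 0"
      using A i odometer_basis_carry[of i L k \<rho>] by metis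
    then show "coord f ?\<nu> = 0"
      by (simp add: cinner_basis_tensor_left cinner_self_eq_zero)
  qed
  show ?C
    using A odometer_basis_replicate by metis
next
  assume BC: "?B \<and> ?C"
  show ?A
  proof (intro allI)
    fix \<mu> \<eta>
    show "cinner (odometer_basis L \<mu> \<eta>) f = 0"
    proof (cases \<mu> rule: words_split[of _ last_letter])
      case (1 m)
      then show ?thesis
        using BC by (simp add: odometer_basis_replicate)
    next
      case (2 k i \<rho>)
      \<comment> \<open>A letter above \<open>i\<close> is not the least one, so the image word is
        among those at which \<open>f\<close> vanishes.\<close>
      then have "next_letter i \<noteq> first_letter"
        using next_letter_less[of i] first_letter_le[of i] by auto
      then show ?thesis
        using BC 2 by (simp add: odometer_basis_carry cinner_basis_tensor_left)
    qed
  qed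
qed

text \<open>Basis vectors at words with another letter are orthogonal to all generators. Conversely,
  every term in the expansion of \<open>f\<close> is a generator or 0, and the finite partial sums
  converge to \<open>f\<close>.\<close>

lemma closure_cspan_powers_iff:
  fixes f :: "('n::{finite, linorder}, 'e::complex_hilbert) fock"
  shows "f \<in> closure (cspan {replicate m first_letter \<otimes>\<^sub>e \<eta> | m \<eta>. True}) \<longleftrightarrow>
    (\<forall>k j \<rho>. j \<noteq> first_letter \<longrightarrow> coord f (replicate k first_letter @ j # \<rho>) = 0)"
    (is "f \<in> closure (cspan ?G) \<longleftrightarrow> ?B")
proof
  assume f: "f \<in> closure (cspan ?G)"
  have "coord f (replicate k first_letter @ j # \<rho>) = 0" if "j \<noteq> first_letter" for k j \<rho>
  proof -
    let ?\<nu> = "replicate k first_letter @ j # \<rho>"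
    have "?\<nu> \<noteq> replicate m first_letter" for m
      using that by (metis in_set_conv_decomp in_set_replicate)
    then have "cinner (?\<nu> \<otimes>\<^sub>e coord f ?\<nu>) x = 0" if "x \<in> ?G" for x
      using that by (auto simp: cinner_basis_tensor)
    then have "cinner (?\<nu> \<otimes>\<^sub>e coord f ?\<nu>) f = 0"
      using f by (rule cinner_closure_cspan)
    then show ?thesis
      by (simp add: cinner_basis_tensor_left cinner_self_eq_zero)
  qed
  then show ?B by blast
next
  assume B: ?B
  have in_span: "\<mu> \<otimes>\<^sub>e coord f \<mu> \<in> cspan ?G" for \<mu>
  proof (cases \<mu> rule: words_split[of _ first_letter])
    case (1 m)
    then show ?thesis
      by (intro complex_vector.span_base) blast
  next
    case (2 k j \<rho>)
    then have "\<mu> \<otimes>\<^sub>e coord f \<mu> = 0"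
      using B by (intro ell2_eqI) (simp add: coord_basis_tensor)
    then show ?thesis
      by (simp add: complex_vector.span_zero)
  qed
  show "f \<in> closure (cspan ?G)"
  proof (rule Lim_in_closed_set[OF closed_closure])
    show "(sum (\<lambda>\<mu>. \<mu> \<otimes>\<^sub>e coord f \<mu>) \<longlongrightarrow> f) (finite_subsets_at_top UNIV)"
      using has_sum_basis_tensor[of f] by (simp add: has_sum_def)
    show "\<forall>\<^sub>F F in finite_subsets_at_top UNIV. sum (\<lambda>\<mu>. \<mu> \<otimes>\<^sub>e coord f \<mu>) F \<in> closure (cspan ?G)"
      using in_span closure_subset[of "cspan ?G"]
      by (intro always_eventually allI) (meson complex_vector.span_sum subsetD)
  qed simp
qed

text \<open>The support condition comes from the closed span of powers; orthogonality to the shifts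
  with \<open>1 \<le> p\<close> and to \<open>range L\<close> together gives orthogonality to every
  \<open>shift1 m (L \<eta>)\<close>.\<close>

lemma E_space_ominus_range:
  fixes L :: "'e::complex_hilbert \<Rightarrow> ('n::{finite, linorder}, 'e) fock"
  shows "E_space L \<ominus> range L = {f. \<forall>\<mu> \<eta>. cinner (odometer_basis L \<mu> \<eta>) f = 0}"
proof -
  have "(\<forall>x\<in>closure (cspan {shift1 p (L \<zeta>) | p \<zeta>. 1 \<le> p}). cinner f x = 0)
      \<and> (\<forall>x\<in>range L. cinner f x = 0) \<longleftrightarrow> (\<forall>m \<eta>. cinner (shift1 m (L \<eta>)) f = 0)"
    (is "(\<forall>x\<in>closure (cspan ?P). _) \<and> ?R \<longleftrightarrow> ?C") for f
  proof
    assume orth: "(\<forall>x\<in>closure (cspan ?P). cinner f x = 0) \<and> ?R"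
    show ?C
    proof (intro allI)
      fix m \<eta>
      show "cinner (shift1 m (L \<eta>)) f = 0"
      proof (cases m)
        \<comment> \<open>\<open>shift1 0\<close> is the identity, so this case is orthogonality to
          \<open>range L\<close>.\<close>
        case 0
        then show ?thesis
          using orth by (simp add: shift1_def cinner_eq_zero_commute[of f])
      next
        case (Suc p)
        then have "shift1 m (L \<eta>) \<in> ?P"
          by (intro CollectI exI[of _ m]) auto
        then have "shift1 m (L \<eta>) \<in> closure (cspan ?P)"
          by (intro subsetD[OF closure_subset] complex_vector.span_base)
        with orth show ?thesis
          by (simp add: cinner_eq_zero_commute[of f])
      qed
    qed
  next
    assume C: ?C
    then have "cinner f x = 0" if "x \<in> ?P" for x
      using that by (auto simp: cinner_eq_zero_commute[of f])
    then have "\<forall>x\<in>closure (cspan ?P). cinner f x = 0"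
      using cinner_closure_cspan by blast
    moreover have ?R
      using C[rule_format, of 0] by (auto simp: shift1_def cinner_eq_zero_commute[of f])
    ultimately show "(\<forall>x\<in>closure (cspan ?P). cinner f x = 0) \<and> ?R"
      by blast
  qed
  then show ?thesis
    unfolding E_space_def ominus_def
    by (intro set_eqI) (simp only: mem_Collect_eq closure_cspan_powers_iff
        orthogonal_odometer_basis_iff conj_assoc)
qed

lemma ker_cadjoint_odometer:
  fixes L :: "'e::complex_hilbert \<Rightarrow> ('n::{finite, linorder}, 'e) fock"
  assumes "bounded_clinear L" "isometry (odometer L)"
  shows "ker (cadjoint (odometer L)) = E_space L \<ominus> range L"
proof -
  interpret isometric_operator "odometer L"
    using assms(2) by unfold_locales
  have "(\<forall>x. cinner (odometer L x) f = 0) \<longleftrightarrow> (\<forall>\<mu> \<eta>. cinner (odometer_basis L \<mu> \<eta>) f = 0)" for f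
  proof
    assume "\<forall>x. cinner (odometer L x) f = 0"
    then show "\<forall>\<mu> \<eta>. cinner (odometer_basis L \<mu> \<eta>) f = 0"
      using odometer_basis_tensor[OF assms(1)] by metis
  next
    assume "\<forall>\<mu> \<eta>. cinner (odometer_basis L \<mu> \<eta>) f = 0"
    \<comment> \<open>Instead of expanding \<open>x\<close>, the coordinates of the adjoint value
      are computed: pairing with the basis vector carrying the coordinate itself gives a vanishing
      squared norm.\<close>
    then have "coord (cadjoint (odometer L) f) \<mu> = 0" for \<mu>
      using cinner_cadjoint[of "\<mu> \<otimes>\<^sub>e coord (cadjoint (odometer L) f) \<mu>" f]
      by (simp add: odometer_basis_tensor[OF assms(1)] cinner_basis_tensor_left cinner_self_eq_zero)
    then have "cadjoint (odometer L) f = 0"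
      by (intro ell2_eqI) simp
    then show "\<forall>x. cinner (odometer L x) f = 0"
      by (simp add: cinner_cadjoint)
  qed
  then show ?thesis
    by (simp add: ker_cadjoint E_space_ominus_range)
qed

theorem proposition7p5:
  fixes L :: "'e::{complex_hilbert, second_countable_topology} \<Rightarrow> ('n::{finite, linorder}, 'e) fock"
  assumes "bounded_clinear L"
    and "isometric_representation L"
  shows "(fredholm (odometer L) \<longleftrightarrow> essentially_normal (odometer L))
    \<and> (essentially_normal (odometer L) \<longleftrightarrow> finite_cdim (E_space L \<ominus> range L))
    \<and> (fredholm (odometer L) \<longrightarrow>
        fredholm_index (odometer L) = - int (cdim (E_space L \<ominus> range L)))"
proof -
  have isometry: "isometry (odometer L)"
    using assms(2) by (simp add: isometric_representation_def)
  then interpret isometric_operator "odometer L"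
    by unfold_locales
  show ?thesis
    using fredholm_iff fredholm_index_eq isometry_essentially_normal_iff[OF isometry]
    by (simp add: ker_cadjoint_odometer[OF assms(1) isometry])
qed

end
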